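(* Let $F$ be an analytic function defined in a neighbourhood of $0\in\mathbb{C}$ such that $F(0)\neq0$, $F'(0)=F''(0)=0$, and $F^{(n)}(0)\neq0$ for some $n\geq3$. Let $K$ be the Gaussian curvature of the modular surface in $\mathbb{E}_1^3$ induced by $F$. Then $K(0)=0$, and in a deleted neighbourhood of $z=0$ the Gaussian curvature $K$ is positive.
   Context: $\mathbb{E}_1^3$ denotes $\mathbb{R}^3$ with the Lorentzian metric $dx^2+dy^2-dt^2$; $(x,y)$ is identified with $z=x+iy$. The modular surface induced by an analytic function $F$ is the graph $(x,y,h(x,y))$ with $h=|F|$. Its Gaussian curvature in $\mathbb{E}_1^3$, as a function of $z$, is $$K=-\frac{h_{xx}h_{yy}-h_{xy}^2}{(1-h_x^2-h_y^2)^2},$$ which where $F\neq0$ and $|F'|\neq1$ equals $-\dfrac{|F'|^4-|2FF''-(F')^2|^2}{4|F|^2(1-|F'|^2)^2}$. $F$ is not required to be the square of an analytic function. $F^{(k)}$ denotes the $k$-th complex derivative. *)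

theory Defs
  imports "HOL-Complex_Analysis.Complex_Analysis"
begin

definition partial_x :: "(real \<Rightarrow> real \<Rightarrow> real) \<Rightarrow> real \<Rightarrow> real \<Rightarrow> real" where
  "partial_x h x y = deriv (\<lambda>s. h s y) x"

definition partial_y :: "(real \<Rightarrow> real \<Rightarrow> real) \<Rightarrow> real \<Rightarrow> real \<Rightarrow> real" where
  "partial_y h x y = deriv (\<lambda>t. h x t) y"

(* Gaussian curvature of the graph (x, y, h(x,y)) for the ambient metric
   dx^2 + dy^2 - dt^2.  The induced metric has determinant 1 - h_x^2 - h_y^2.  The formula is
   meaningful where h is twice continuously differentiable and this determinant is nonzero;
   where the determinant vanishes, the value is 0 by the convention x / 0 = 0. *)
definition lorentz_graph_curvature :: "(real \<Rightarrow> real \<Rightarrow> real) \<Rightarrow> real \<Rightarrow> real \<Rightarrow> real" where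
  "lorentz_graph_curvature h x y =
     - ((partial_x (partial_x h) x y * partial_y (partial_y h) x y
          - (partial_y (partial_x h) x y)\<^sup>2)
        / (1 - (partial_x h x y)\<^sup>2 - (partial_y h x y)\<^sup>2)\<^sup>2)"

definition modular_height :: "(complex \<Rightarrow> complex) \<Rightarrow> real \<Rightarrow> real \<Rightarrow> real" where
  "modular_height F x y = cmod (F (Complex x y))"

definition modular_surface_curvature :: "(complex \<Rightarrow> complex) \<Rightarrow> complex \<Rightarrow> real" where
  "modular_surface_curvature F z = lorentz_graph_curvature (modular_height F) (Re z) (Im z)"

end

theory Submission
  imports Defs
begin

text \<open>Taking a holomorphic square root makes the curvature computable. Near \<open>0\<close> the function \<open>F\<close> has no zero, so \<open>F = G\<^sup>2\<close>
  with \<open>G\<close> holomorphic, and the height \<open>|F| = G * cnj G\<close> becomes a product that differentiates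
  without any square root of real functions. Its Hessian determinant is
  \<open>4 * (|G'|^4 - |G''|\<^sup>2 * |G|\<^sup>2)\<close>, so the curvature is positive exactly where
  \<open>|G'|\<^sup>2 < |G''| * |G|\<close> and the induced metric is nondegenerate
  (lemma \<open>modular_surface_curvature_square\<close>).

  From \<open>F'(0) = F''(0) = 0\<close> and \<open>F(0) \<noteq> 0\<close> follows \<open>G'(0) = G''(0) = 0\<close>, hence \<open>K(0) = 0\<close>.
  Since some higher derivative of \<open>F\<close> survives, \<open>G'\<close> is not identically zero and vanishes at \<open>0\<close> to
  some finite order \<open>n \<ge> 1\<close>. Then \<open>G'\<^sup>2\<close> vanishes to order \<open>2 * n\<close> but \<open>G'' * G\<close> only to order
  \<open>n - 1\<close>, so the second term dominates in a punctured neighbourhood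
  (lemma \<open>deriv_square_dominated_near_zero\<close>).\<close>

section \<open>Curvature of a modular surface in terms of a square root\<close>

text \<open>Both partial derivatives come from this one rule: the coordinate lines are curves \<open>c\<close> with
  velocity \<open>d = 1\<close> and \<open>d = \<i>\<close>.\<close>

lemma has_real_derivative_Re_mult_cnj:
  fixes A B :: "complex \<Rightarrow> complex" and c :: "real \<Rightarrow> complex"
  assumes "(c has_vector_derivative d) (at s)"
    and "(A has_field_derivative A') (at (c s))" and "(B has_field_derivative B') (at (c s))"
  shows "((\<lambda>s. Re (A (c s) * cnj (B (c s)))) has_real_derivative
           Re (d * A' * cnj (B (c s)) + A (c s) * cnj (d * B'))) (at s)"
proof -
  have A: "((\<lambda>s. A (c s)) has_vector_derivative d * A') (at s)"
    using field_vector_diff_chain_at[OF assms(1,2)] by (simp add: o_def)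
  have B: "((\<lambda>s. B (c s)) has_vector_derivative d * B') (at s)"
    using field_vector_diff_chain_at[OF assms(1,3)] by (simp add: o_def)
  have "((\<lambda>s. A (c s) * cnj (B (c s))) has_vector_derivative
           A (c s) * cnj (d * B') + d * A' * cnj (B (c s))) (at s)"
    by (intro has_vector_derivative_mult A has_vector_derivative_cnj B)
  from bounded_linear.has_vector_derivative[OF bounded_linear_Re this] show ?thesis
    by (simp add: has_real_derivative_iff_has_vector_derivative add.commute)
qed

lemma has_vector_derivative_Complex:
  shows "((\<lambda>s. Complex s y) has_vector_derivative 1) (at x)"
    and "((\<lambda>t. Complex x t) has_vector_derivative \<i>) (at y)"
  unfolding Complex_eq by (auto intro!: derivative_eq_intros)

lemma eventually_Complex_in_open:
  assumes "open S" "Complex x y \<in> S"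
  shows "\<forall>\<^sub>F s in nhds x. Complex s y \<in> S" and "\<forall>\<^sub>F t in nhds y. Complex x t \<in> S"
proof -
  have "isCont (\<lambda>s. Complex s y) x" "isCont (\<lambda>t. Complex x t) y"
    using has_vector_derivative_Complex has_vector_derivative_continuous by blast+
  then show "\<forall>\<^sub>F s in nhds x. Complex s y \<in> S" "\<forall>\<^sub>F t in nhds y. Complex x t \<in> S"
    using assms by (auto simp: isCont_def tendsto_def eventually_at_filter
       elim!: allE[of _ S] eventually_mono)
qed

text \<open>Both partial derivatives are kept as the real part of a holomorphic function times \<open>cnj G\<close>, the
  shape of the height itself, so that the same rule yields the second derivatives.\<close>

lemma modular_height_partials_square:
  assumes S: "open S" and G: "G holomorphic_on S" and F: "\<And>w. w \<in> S \<Longrightarrow> F w = (G w)\<^sup>2"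
    and z: "Complex x y \<in> S"
  shows "partial_x (modular_height F) x y
           = Re (2 * deriv G (Complex x y) * cnj (G (Complex x y)))"
    and "partial_y (modular_height F) x y
           = Re (2 * \<i> * deriv G (Complex x y) * cnj (G (Complex x y)))"
proof -
  have h: "modular_height F s t = Re (G (Complex s t) * cnj (G (Complex s t)))"
    if "Complex s t \<in> S" for s t
    using F[OF that] by (simp add: modular_height_def norm_power complex_norm_square[symmetric]
      del: complex_cnj_mult times_complex.sel)
  have D: "(G has_field_derivative deriv G (Complex x y)) (at (Complex x y))"
    using holomorphic_derivI[OF G S z] .
  show "partial_x (modular_height F) x y
           = Re (2 * deriv G (Complex x y) * cnj (G (Complex x y)))"
    unfolding partial_x_def
    using has_real_derivative_Re_mult_cnj[OF has_vector_derivative_Complex(1) D D]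
    by (subst deriv_cong_ev[OF eventually_mono[OF eventually_Complex_in_open(1)[OF S z] h] refl])
       (auto dest!: DERIV_imp_deriv simp: algebra_simps)
  show "partial_y (modular_height F) x y
           = Re (2 * \<i> * deriv G (Complex x y) * cnj (G (Complex x y)))"
    unfolding partial_y_def
    using has_real_derivative_Re_mult_cnj[OF has_vector_derivative_Complex(2) D D]
    by (subst deriv_cong_ev[OF eventually_mono[OF eventually_Complex_in_open(2)[OF S z] h] refl])
       (auto dest!: DERIV_imp_deriv simp: algebra_simps)
qed

text \<open>With \<open>a = G'' * cnj G\<close> the Hessian of \<open>G * cnj G\<close> is \<open>2 * |G'|\<^sup>2\<close> times the identity plus
  the symmetric trace-free matrix with entries \<open>2 * Re a\<close> and \<open>- 2 * Im a\<close>. The latter has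
  eigenvalues \<open>2 * |a|\<close> and \<open>- 2 * |a|\<close>, so the determinant is a difference of two squares.\<close>

lemma modular_surface_curvature_square:
  assumes S: "open S" and G: "G holomorphic_on S" and F: "\<And>w. w \<in> S \<Longrightarrow> F w = (G w)\<^sup>2"
    and z: "z \<in> S"
  shows "modular_surface_curvature F z =
    4 * ((cmod (deriv (deriv G) z * G z))\<^sup>2 - (cmod (deriv G z))^4)
      / (1 - 4 * (cmod (deriv G z * G z))\<^sup>2)\<^sup>2"
proof -
  define x y where "x = Re z" and "y = Im z"
  have zxy: "z = Complex x y" by (simp add: x_def y_def)
  have z': "Complex x y \<in> S" using z zxy by simp
  let ?h = "modular_height F"
  note p = modular_height_partials_square[OF S G F]
  have D: "(G has_field_derivative deriv G z) (at (Complex x y))"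
    using holomorphic_derivI[OF G S z] zxy by simp
  have D2: "((\<lambda>w. k * deriv G w) has_field_derivative k * deriv (deriv G) z) (at (Complex x y))" for k
    using holomorphic_derivI[OF holomorphic_deriv[OF G S] S z] zxy by (auto intro: DERIV_cmult)
  note ex = eventually_Complex_in_open(1)[OF S z'] and ey = eventually_Complex_in_open(2)[OF S z']
  define a where "a = deriv (deriv G) z * cnj (G z)"
  have xx: "partial_x (partial_x ?h) x y = 2 * Re a + 2 * (cmod (deriv G z))\<^sup>2"
    unfolding partial_x_def[of "partial_x ?h"]
    using has_real_derivative_Re_mult_cnj[OF has_vector_derivative_Complex(1) D2[of 2] D]
    by (subst deriv_cong_ev[OF eventually_mono[OF ex p(1)] refl])
       (auto dest!: DERIV_imp_deriv simp: algebra_simps a_def zxy cmod_def power2_eq_square)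
  have xy: "partial_y (partial_x ?h) x y = - 2 * Im a"
    unfolding partial_y_def[of "partial_x ?h"]
    using has_real_derivative_Re_mult_cnj[OF has_vector_derivative_Complex(2) D2[of 2] D]
    by (subst deriv_cong_ev[OF eventually_mono[OF ey p(1)] refl])
       (auto dest!: DERIV_imp_deriv simp: algebra_simps a_def zxy cmod_def power2_eq_square)
  have yy: "partial_y (partial_y ?h) x y = - 2 * Re a + 2 * (cmod (deriv G z))\<^sup>2"
    unfolding partial_y_def[of "partial_y ?h"]
    using has_real_derivative_Re_mult_cnj[OF has_vector_derivative_Complex(2) D2[of "2 * \<i>"] D]
    by (subst deriv_cong_ev[OF eventually_mono[OF ey p(2)] refl])
       (auto dest!: DERIV_imp_deriv simp: algebra_simps a_def zxy cmod_def power2_eq_square)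
  have quartic: "(cmod w)^4 = ((Re w)\<^sup>2 + (Im w)\<^sup>2)\<^sup>2" for w
    by (simp flip: cmod_power2)
  have hess: "partial_x (partial_x ?h) x y * partial_y (partial_y ?h) x y
      - (partial_y (partial_x ?h) x y)\<^sup>2 = 4 * (cmod (deriv G z))^4 - 4 * (cmod a)\<^sup>2"
    unfolding xx xy yy by (simp add: cmod_power2 quartic) algebra
  define b where "b = deriv G z * cnj (G z)"
  have "(partial_x ?h x y)\<^sup>2 + (partial_y ?h x y)\<^sup>2 = 4 * (cmod b)\<^sup>2"
  proof -
    have "partial_x ?h x y = 2 * Re b" "partial_y ?h x y = - 2 * Im b"
      using p[OF _ z'] by (simp_all add: b_def zxy)
    then show ?thesis by (simp add: cmod_power2 power_mult_distrib)
  qed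
  then have det: "1 - (partial_x ?h x y)\<^sup>2 - (partial_y ?h x y)\<^sup>2 = 1 - 4 * (cmod b)\<^sup>2"
    by simp
  have "cmod a = cmod (deriv (deriv G) z * G z)" "cmod b = cmod (deriv G z * G z)"
    by (simp_all add: a_def b_def norm_mult)
  then show ?thesis
    unfolding modular_surface_curvature_def lorentz_graph_curvature_def
    by (simp only: x_def[symmetric] y_def[symmetric] hess det)
       (simp add: algebra_simps minus_divide_left)
qed

section \<open>Orders of vanishing\<close>

text \<open>The origin is an isolated zero of \<open>f\<close>, so \<open>f(z) = z^n * g(z)\<close> with \<open>n \<ge> 1\<close> and
  \<open>g(0) \<noteq> 0\<close>, and \<open>f'(z) = z^(n-1) * (n * g(z) + z * g'(z))\<close>. Cancelling \<open>|z|^(n-1)\<close> from the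
  claim leaves an inequality between continuous functions (\<open>L\<close> and \<open>R\<close> in the proof) whose
  sides are \<open>0\<close> and \<open>n * |g(0)| * |G(0)| > 0\<close> at the origin.\<close>

lemma deriv_square_dominated_near_zero:
  assumes S: "open S" "connected S" "0 \<in> S"
    and f: "f holomorphic_on S" "f 0 = 0" "\<not> f constant_on S"
    and G: "G holomorphic_on S" "G 0 \<noteq> 0"
  shows "\<forall>\<^sub>F z in at 0. (cmod (f z))\<^sup>2 < cmod (deriv f z * G z)"
proof -
  obtain g r n where n: "0 < n" and r: "0 < r" "ball 0 r \<subseteq> S" and g: "g holomorphic_on ball 0 r"
    and fg: "\<And>w. w \<in> ball 0 r \<Longrightarrow> f w = (w - 0) ^ n * g w" and g0: "\<And>w. w \<in> ball 0 r \<Longrightarrow> g w \<noteq> 0"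
    using holomorphic_factor_zero_nonconstant[OF f(1) S f(2,3)] by metis
  define L where "L = (\<lambda>z. cmod (z ^ (n + 1)) * (cmod (g z))\<^sup>2)"
  define R where "R = (\<lambda>z. cmod ((of_nat n * g z + z * deriv g z) * G z))"
  have cont: "isCont g 0" "isCont (deriv g) 0" "isCont G 0"
    using r g G S holomorphic_deriv[OF g]
    by (auto intro!: continuous_on_interior[OF holomorphic_on_imp_continuous_on] simp: interior_open)
  have "((\<lambda>z. R z - L z) \<longlongrightarrow> R 0 - L 0) (at 0)"
    using cont unfolding L_def R_def isCont_def by (intro tendsto_intros)
  moreover have "R 0 - L 0 > 0"
    using n r g0[of 0] G(2) by (simp add: L_def R_def)
  ultimately have "\<forall>\<^sub>F z in at 0. R z - L z > 0"
    by (rule order_tendstoD)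
  moreover have "\<forall>\<^sub>F z in at 0. z \<in> ball 0 r - {0::complex}"
    using r by (intro eventually_at_in_open) auto
  ultimately show ?thesis
  proof eventually_elim
    case (elim z)
    then have z: "z \<in> ball 0 r" "z \<noteq> 0" and LR: "L z < R z" by auto
    obtain m where m: "n = Suc m" using n gr0_implies_Suc by blast
    have "((\<lambda>w. w ^ n * g w) has_field_derivative z ^ m * (of_nat n * g z + z * deriv g z)) (at z)"
      by (rule derivative_eq_intros holomorphic_derivI[OF g open_ball z(1)] refl)+
         (simp add: m algebra_simps)
    moreover have "\<forall>\<^sub>F w in nhds z. f w = w ^ n * g w"
      using eventually_nhds_in_open[OF open_ball z(1)] by eventually_elim (simp add: fg)
    ultimately have df: "deriv f z = z ^ m * (of_nat n * g z + z * deriv g z)"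
      using deriv_cong_ev[of f "\<lambda>w. w ^ n * g w" z z] DERIV_imp_deriv by metis
    have "(cmod (f z))\<^sup>2 = cmod (z ^ m) * L z"
      using z by (simp add: fg L_def m norm_mult norm_power power_mult_distrib power2_eq_square)
    also have "\<dots> < cmod (z ^ m) * R z"
      using LR z by (intro mult_strict_left_mono) auto
    also have "\<dots> = cmod (deriv f z * G z)"
      by (simp add: df R_def norm_mult)
    finally show ?case .
  qed
qed

theorem proposition3p1:
  fixes F :: "complex \<Rightarrow> complex" and U :: "complex set"
  assumes "open U" and "0 \<in> U"
    and "F analytic_on U"
    and "F 0 \<noteq> 0"
    and "deriv F 0 = 0"
    and "(deriv ^^ 2) F 0 = 0"
    and "\<exists>n\<ge>3. (deriv ^^ n) F 0 \<noteq> 0"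
  shows "modular_surface_curvature F 0 = 0 \<and>
    (\<exists>r>0. ball 0 r \<subseteq> U \<and> (\<forall>z\<in>ball 0 r - {0}. modular_surface_curvature F z > 0))"
proof -
  have FU: "F holomorphic_on U" using assms(3) analytic_imp_holomorphic by blast
  have "isCont F 0"
    using FU assms(1,2)
    by (auto intro!: continuous_on_interior[OF holomorphic_on_imp_continuous_on] simp: interior_open)
  then have "\<forall>\<^sub>F z in nhds 0. F z \<noteq> 0"
    using \<open>F 0 \<noteq> 0\<close> by (simp add: isCont_def tendsto_imp_eventually_ne eventually_nhds_conv_at)
  then have "\<forall>\<^sub>F z in nhds 0. F z \<noteq> 0 \<and> z \<in> U"
    using eventually_nhds_in_open[OF assms(1,2)] by eventually_elim simp
  then obtain e where e: "e > 0" "\<And>z. z \<in> ball 0 e \<Longrightarrow> F z \<noteq> 0 \<and> z \<in> U"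
    unfolding eventually_nhds_metric by (auto simp: dist_commute)
  define S :: "complex set" where "S = ball 0 e"
  have S: "open S" "connected S" "0 \<in> S" "S \<subseteq> U" using e by (auto simp: S_def)
  have FS: "F holomorphic_on S" using FU S(4) holomorphic_on_subset by blast
  obtain G where G: "G holomorphic_on S" and FG: "\<And>z. z \<in> S \<Longrightarrow> F z = (G z)\<^sup>2"
    using contractible_imp_holomorphic_sqrt[OF FS] e
    by (metis S_def convex_ball convex_imp_contractible)
  have G0: "G 0 \<noteq> 0" using FG[OF S(3)] \<open>F 0 \<noteq> 0\<close> by auto
  have dG: "deriv G holomorphic_on S" using holomorphic_deriv[OF G S(1)] .
  have dF: "deriv F z = 2 * G z * deriv G z" if "z \<in> S" for z
  proof -
    have "((\<lambda>z. (G z)\<^sup>2) has_field_derivative 2 * G z * deriv G z) (at z)"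
      by (rule derivative_eq_intros holomorphic_derivI[OF G S(1) that] refl)+ simp
    then show ?thesis
      using deriv_cong_ev[of F "\<lambda>z. (G z)\<^sup>2" z z] eventually_nhds_in_open[OF S(1) that]
        FG DERIV_imp_deriv by (smt (verit) eventually_mono)
  qed
  have G1: "deriv G 0 = 0" using dF[OF S(3)] G0 assms(5) by simp
  have G2: "deriv (deriv G) 0 = 0"
  proof -
    have "((\<lambda>z. 2 * G z * deriv G z) has_field_derivative 2 * G 0 * deriv (deriv G) 0) (at 0)"
      by (rule derivative_eq_intros holomorphic_derivI[OF G S(1,3)] holomorphic_derivI[OF dG S(1,3)] refl)+
         (simp add: G1)
    then have "deriv (deriv F) 0 = 2 * G 0 * deriv (deriv G) 0"
      using deriv_cong_ev[of "deriv F" "\<lambda>z. 2 * G z * deriv G z" 0 0] eventually_nhds_in_open[OF S(1,3)]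
        dF DERIV_imp_deriv by (smt (verit) eventually_mono)
    then show ?thesis using G0 assms(6) by (simp add: numeral_2_eq_2)
  qed
  note K = modular_surface_curvature_square[OF S(1) G FG]
  have K0: "modular_surface_curvature F 0 = 0"
    using K[OF _ S(3)] by (simp add: G1 G2)
  \<comment> \<open>A constant \<open>G'\<close> would be \<open>0\<close>, making \<open>F\<close> constant and killing all its derivatives.\<close>
  have nonconst: "\<not> deriv G constant_on S"
  proof
    assume "deriv G constant_on S"
    then have "deriv G z = 0" if "z \<in> S" for z
      using that S(3) G1 unfolding constant_on_def by metis
    then have dF0: "deriv F z = 0" if "z \<in> S" for z
      using dF that by simp
    obtain n where n: "n \<ge> 3" "(deriv ^^ n) F 0 \<noteq> 0" using assms(7) by blast
    then obtain m where m: "n = Suc m" by (cases n) auto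
    have "(deriv ^^ n) F 0 = (deriv ^^ m) (deriv F) 0"
      by (simp add: m funpow_Suc_right del: funpow.simps)
    also have "\<dots> = (deriv ^^ m) (\<lambda>_. 0) 0"
      using eventually_nhds_in_open[OF S(1,3)] dF0
      by (intro higher_deriv_cong_ev) (auto elim: eventually_mono)
    also have "\<dots> = 0" by simp
    finally show False using n by simp
  qed
  have "\<forall>\<^sub>F z in at 0. (cmod (deriv G z))\<^sup>2 < cmod (deriv (deriv G) z * G z)"
    using deriv_square_dominated_near_zero[OF S(1-3) dG G1 nonconst G G0] .
  \<comment> \<open>Near \<open>0\<close> the induced metric is nondegenerate, so the denominator of the curvature is not zero.\<close>
  moreover have "\<forall>\<^sub>F z in at 0. 4 * (cmod (deriv G z * G z))\<^sup>2 < 1"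
  proof -
    have "isCont G 0" "isCont (deriv G) 0"
      using G dG S
      by (auto intro!: continuous_on_interior[OF holomorphic_on_imp_continuous_on] simp: interior_open)
    then have "((\<lambda>z. 4 * (cmod (deriv G z * G z))\<^sup>2) \<longlongrightarrow> 4 * (cmod (deriv G 0 * G 0))\<^sup>2) (at 0)"
      unfolding isCont_def by (intro tendsto_intros)
    then show ?thesis by (rule order_tendstoD) (simp add: G1)
  qed
  moreover have "\<forall>\<^sub>F z in at 0. z \<in> S"
    using eventually_at_in_open'[OF S(1,3)] .
  ultimately have "\<forall>\<^sub>F z in at 0. z \<in> S \<and> modular_surface_curvature F z > 0"
  proof eventually_elim
    case (elim z)
    have "((cmod (deriv G z))\<^sup>2)\<^sup>2 < (cmod (deriv (deriv G) z * G z))\<^sup>2"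
      using elim by (intro power_strict_mono) auto
    then have "(cmod (deriv G z))^4 < (cmod (deriv (deriv G) z * G z))\<^sup>2"
      by simp
    then show ?case using elim K by (auto intro!: divide_pos_pos)
  qed
  then obtain d where d: "d > 0"
      "\<And>z. z \<noteq> 0 \<Longrightarrow> dist z 0 < d \<Longrightarrow> z \<in> S \<and> modular_surface_curvature F z > 0"
    unfolding eventually_at by auto
  then have "ball 0 d \<subseteq> U"
    using S by (metis dist_commute mem_ball subset_iff)
  with d K0 show ?thesis
    by (intro conjI exI[of _ d]) (auto simp: dist_commute)
qed

end
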